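(* Let $X$ be a metrizable, separable, locally compact space, let $\mathcal F=\{f_1,\dots,f_m\}$ be an iterated function system on $X$ with compact dynamics and global attractor $\mathcal G_{\mathcal F}$, and let $L:X\to[0,1]$ be a strict Lyapunov function for the chain stream $\mathcal C_{\mathcal F}$. Then, for every $x\in\mathcal G_{\mathcal F}$, exactly one of the following three alternatives occurs. (1) (Orbitwise recurrent dynamics) $x$ is orbitwise chain-recurrent; this holds if and only if $L(\Phi^I_{\mathcal F}(x))=L(x)$ for every $I\in\mathcal I^m$. (2) (Mixed recurrent–gradient dynamics) $x$ is chain-recurrent but not orbitwise chain-recurrent; this holds if and only if $L(f_i(x))=L(x)$ for some $i\in\{1,\dots,m\}$, while $L(\Phi^I_{\mathcal F}(x))<L(x)$ for some $I\in\mathcal I^m$. (3) (Gradient dynamics) $x$ is not chain-recurrent; this holds if and only if $L(f_i(x))<L(x)$ for every $i=1,\dots,m$.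
   Context: Fix any metric $d$ on $X$ compatible with its topology. An iterated function system (IFS) on $X$ is a finite collection $\mathcal F=\{f_1,\dots,f_m\}$, $m\ge1$, of continuous maps $X\to X$. $\mathcal I^m$ is the set of all finite words in the letters $1,\dots,m$ (including the empty word $0$); $|I|$ is the length of $I$. For $I=i_1\cdots i_k$, $\Phi^I_{\mathcal F}=f_{i_k}\circ\dots\circ f_{i_1}$, and $\Phi^0_{\mathcal F}=\mathrm{id}_X$. $H_{\mathcal F}(A)=\bigcup_{i=1}^m f_i(A)$; $A$ is $H$-invariant if $H_{\mathcal F}(A)=A$. The orbit of $x$ is $\mathcal O_{\mathcal F}(x)=\{\Phi^I_{\mathcal F}(x): I\in\mathcal I^m\}$. $N_\varepsilon(A)=\{x:d(x,A)<\varepsilon\}$. $A$ attracts $K$ if for every $\varepsilon>0$ there is $\tau>0$ with $\Phi^I_{\mathcal F}(K)\subset N_\varepsilon(A)$ for every $|I|\ge\tau$. A global attractor is a compact $H$-invariant set that attracts every compact subset of $X$; it is unique if it exists and is denoted $\mathcal G_{\mathcal F}$. $\mathcal F$ has compact dynamics if it has a global attractor. Chains: an $\varepsilon$-chain from $x$ to $y$ is a finite sequence $x_0=x,x_1,\dots,x_k=y$ ($k\ge0$) in $X$ with indices $i_0,\dots,i_{k-1}$ such that $d(f_{i_n}(x_n),x_{n+1})<\varepsilon$ for $n=0,\dots,k-1$. The chain stream is $\mathcal C_{\mathcal F}=\{(x,y):$ for every $\varepsilon>0$ there is an $\varepsilon$-chain from $x$ to $y\}$; write $x\succcurlyeq y$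 for $(x,y)\in\mathcal C_{\mathcal F}$. Points $x,y$ are chain-equivalent if $x\succcurlyeq y$ and $y\succcurlyeq x$. A point $x$ is chain-recurrent if it is chain-equivalent to $f_i(x)$ for some $i$; it is orbitwise chain-recurrent if it is chain-equivalent to every point of $\mathcal O_{\mathcal F}(x)$. A strict Lyapunov function for $\mathcal C_{\mathcal F}$ is a continuous real function $L$ on $X$ such that $x\succcurlyeq y$ implies $L(x)\ge L(y)$, and $x\succcurlyeq y$ together with $y\not\succcurlyeq x$ implies $L(x)>L(y)$. *)

theory Defs
  imports "HOL-Analysis.Analysis"
begin

text \<open>
  The phase space is a type of class \<^class>\<open>metric_space\<close>, so \<^const>\<open>dist\<close> is an arbitrary
  metric compatible with the topology. An iterated function system with \<open>m\<close> maps is given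
  by \<open>m\<close> and a family \<open>f\<close> of which only the members with index in \<open>{1..m}\<close> matter.
\<close>

definition ifs :: "nat \<Rightarrow> (nat \<Rightarrow> 'a::metric_space \<Rightarrow> 'a) \<Rightarrow> bool" where
  "ifs m f \<longleftrightarrow> 1 \<le> m \<and> (\<forall>i\<in>{1..m}. continuous_on UNIV (f i))"

definition ifs_words :: "nat \<Rightarrow> nat list set" where
  "ifs_words m = lists {1..m}"

text \<open>The first letter of a word acts first: \<open>ifs_map f [i1, \<dots>, ik] = f ik \<circ> \<dots> \<circ> f i1\<close>.\<close>

definition ifs_map :: "(nat \<Rightarrow> 'a \<Rightarrow> 'a) \<Rightarrow> nat list \<Rightarrow> 'a \<Rightarrow> 'a" where
  "ifs_map f I = fold f I"

definition ifs_orbit :: "nat \<Rightarrow> (nat \<Rightarrow> 'a \<Rightarrow> 'a) \<Rightarrow> 'a \<Rightarrow> 'a set" where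
  "ifs_orbit m f x = {ifs_map f I x | I. I \<in> ifs_words m}"

definition hutchinson :: "nat \<Rightarrow> (nat \<Rightarrow> 'a \<Rightarrow> 'a) \<Rightarrow> 'a set \<Rightarrow> 'a set" where
  "hutchinson m f A = (\<Union>i\<in>{1..m}. f i ` A)"

text \<open>
  Points at distance less than \<open>\<epsilon>\<close> from \<open>A\<close>. We avoid \<^const>\<open>infdist\<close>, which is \<open>0\<close> for
  \<open>A = {}\<close>: the empty set must have empty neighbourhoods, so that it attracts no point.
\<close>

definition set_nbhd :: "real \<Rightarrow> 'a::metric_space set \<Rightarrow> 'a set" where
  "set_nbhd \<epsilon> A = {x. \<exists>a\<in>A. dist x a < \<epsilon>}"

definition attracts :: "nat \<Rightarrow> (nat \<Rightarrow> 'a::metric_space \<Rightarrow> 'a) \<Rightarrow> 'a set \<Rightarrow> 'a set \<Rightarrow> bool" where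
  "attracts m f A K \<longleftrightarrow>
     (\<forall>\<epsilon>>0. \<exists>\<tau>>0. \<forall>I\<in>ifs_words m. \<tau> \<le> length I \<longrightarrow> ifs_map f I ` K \<subseteq> set_nbhd \<epsilon> A)"

definition global_attractor :: "nat \<Rightarrow> (nat \<Rightarrow> 'a::metric_space \<Rightarrow> 'a) \<Rightarrow> 'a set \<Rightarrow> bool" where
  "global_attractor m f G \<longleftrightarrow>
     compact G \<and> hutchinson m f G = G \<and> (\<forall>K. compact K \<longrightarrow> attracts m f G K)"

definition eps_chain :: "nat \<Rightarrow> (nat \<Rightarrow> 'a::metric_space \<Rightarrow> 'a) \<Rightarrow> real \<Rightarrow> 'a \<Rightarrow> 'a \<Rightarrow> bool" where
  "eps_chain m f \<epsilon> x y \<longleftrightarrow>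
     (\<exists>k p i. p 0 = x \<and> p k = y \<and>
        (\<forall>n<k. i n \<in> {1..m} \<and> dist (f (i n) (p n)) (p (Suc n)) < \<epsilon>))"

definition chain_stream :: "nat \<Rightarrow> (nat \<Rightarrow> 'a::metric_space \<Rightarrow> 'a) \<Rightarrow> ('a \<times> 'a) set" where
  "chain_stream m f = {(x, y). \<forall>\<epsilon>>0. eps_chain m f \<epsilon> x y}"

definition chain_equivalent :: "nat \<Rightarrow> (nat \<Rightarrow> 'a::metric_space \<Rightarrow> 'a) \<Rightarrow> 'a \<Rightarrow> 'a \<Rightarrow> bool" where
  "chain_equivalent m f x y \<longleftrightarrow> (x, y) \<in> chain_stream m f \<and> (y, x) \<in> chain_stream m f"

definition chain_recurrent :: "nat \<Rightarrow> (nat \<Rightarrow> 'a::metric_space \<Rightarrow> 'a) \<Rightarrow> 'a \<Rightarrow> bool" where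
  "chain_recurrent m f x \<longleftrightarrow> (\<exists>i\<in>{1..m}. chain_equivalent m f x (f i x))"

definition orbitwise_chain_recurrent ::
  "nat \<Rightarrow> (nat \<Rightarrow> 'a::metric_space \<Rightarrow> 'a) \<Rightarrow> 'a \<Rightarrow> bool" where
  "orbitwise_chain_recurrent m f x \<longleftrightarrow> (\<forall>y\<in>ifs_orbit m f x. chain_equivalent m f x y)"

definition strict_Lyapunov :: "('a::topological_space \<times> 'a) set \<Rightarrow> ('a \<Rightarrow> real) \<Rightarrow> bool" where
  "strict_Lyapunov R L \<longleftrightarrow>
     continuous_on UNIV L \<and>
     (\<forall>x y. (x, y) \<in> R \<longrightarrow> L x \<ge> L y) \<and>
     (\<forall>x y. (x, y) \<in> R \<and> (y, x) \<notin> R \<longrightarrow> L x > L y)"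

end

theory Submission
  imports Defs
begin

text \<open>
  Exact orbit segments are chains, so every point chains to its forward orbit. Hence a strict
  Lyapunov function is weakly decreasing along orbits, and it stays constant from \<open>x\<close> to a point
  of the orbit of \<open>x\<close> exactly when the two are chain-equivalent.
\<close>

lemma chain_stream_ifs_map:
  assumes "I \<in> ifs_words m"
  shows "(x, ifs_map f I x) \<in> chain_stream m f"
proof -
  have "eps_chain m f \<epsilon> x (ifs_map f I x)" if "\<epsilon> > 0" for \<epsilon>
    unfolding eps_chain_def
  proof (intro exI conjI allI impI)
    \<comment> \<open>The witness is the exact orbit segment: the chain has \<open>length I\<close>
      steps, its \<open>n\<close>-th point is the image of \<open>x\<close> under the first
      \<open>n\<close> letters of \<open>I\<close>, and its \<open>n\<close>-th index is
      \<open>I ! n\<close>. Every jump therefore has size 0.\<close>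
    show "fold f (take 0 I) x = x" "fold f (take (length I) I) x = ifs_map f I x"
      by (simp_all add: ifs_map_def)
  next
    fix n assume n: "n < length I"
    then have "I ! n \<in> set I"
      by simp
    with assms show "I ! n \<in> {1..m}"
      unfolding ifs_words_def by blast
    show "dist (f (I ! n) (fold f (take n I) x)) (fold f (take (Suc n) I) x) < \<epsilon>"
      using n that by (simp add: take_Suc_conv_app_nth)
  qed
  then show ?thesis
    by (simp add: chain_stream_def)
qed

lemma strict_Lyapunov_ifs_map_le:
  assumes "strict_Lyapunov (chain_stream m f) L" and "I \<in> ifs_words m"
  shows "L (ifs_map f I x) \<le> L x"
  using assms chain_stream_ifs_map unfolding strict_Lyapunov_def by blast

text \<open>One half of the equivalence, from \<open>x\<close> to its image, always holds. If the
  way back also holds, monotonicity of \<open>L\<close> in both directions forces equality; if it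
  fails, strictness makes \<open>L\<close> drop.\<close>

lemma chain_equivalent_ifs_map_iff:
  assumes "strict_Lyapunov (chain_stream m f) L" and "I \<in> ifs_words m"
  shows "chain_equivalent m f x (ifs_map f I x) \<longleftrightarrow> L (ifs_map f I x) = L x"
  using assms chain_stream_ifs_map[OF assms(2), of x f]
  unfolding strict_Lyapunov_def chain_equivalent_def by (metis order_antisym less_irrefl)

lemma orbitwise_chain_recurrent_iff:
  assumes "strict_Lyapunov (chain_stream m f) L"
  shows "orbitwise_chain_recurrent m f x \<longleftrightarrow> (\<forall>I\<in>ifs_words m. L (ifs_map f I x) = L x)"
  using chain_equivalent_ifs_map_iff[OF assms]
  unfolding orbitwise_chain_recurrent_def ifs_orbit_def by blast

lemma singleton_ifs_words: "i \<in> {1..m} \<Longrightarrow> [i] \<in> ifs_words m"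
  by (simp add: ifs_words_def)

lemma ifs_map_singleton [simp]: "ifs_map f [i] x = f i x"
  by (simp add: ifs_map_def)

text \<open>Chain recurrence tests only the words of length one.\<close>

lemma chain_recurrent_iff:
  assumes "strict_Lyapunov (chain_stream m f) L"
  shows "chain_recurrent m f x \<longleftrightarrow> (\<exists>i\<in>{1..m}. L (f i x) = L x)"
  using chain_equivalent_ifs_map_iff[OF assms singleton_ifs_words, of _ x]
  by (simp add: chain_recurrent_def)

theorem corollary5p17:
  fixes f :: "nat \<Rightarrow> 'a::metric_space \<Rightarrow> 'a" and m :: nat
    and G :: "'a set" and L :: "'a \<Rightarrow> real" and x :: 'a
  assumes "separable_space (euclidean :: 'a topology)"
    and "locally_compact_space (euclidean :: 'a topology)"
    and "ifs m f"
    and "global_attractor m f G"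
    and "L ` UNIV \<subseteq> {0..1}"
    and "strict_Lyapunov (chain_stream m f) L"
    and "x \<in> G"
  defines "alt1 \<equiv> orbitwise_chain_recurrent m f x"
    and "alt2 \<equiv> chain_recurrent m f x \<and> \<not> orbitwise_chain_recurrent m f x"
    and "alt3 \<equiv> \<not> chain_recurrent m f x"
  shows "(alt1 \<and> \<not> alt2 \<and> \<not> alt3 \<or> \<not> alt1 \<and> alt2 \<and> \<not> alt3 \<or> \<not> alt1 \<and> \<not> alt2 \<and> alt3) \<and>
    (alt1 \<longleftrightarrow> (\<forall>I\<in>ifs_words m. L (ifs_map f I x) = L x)) \<and>
    (alt2 \<longleftrightarrow> (\<exists>i\<in>{1..m}. L (f i x) = L x) \<and> (\<exists>I\<in>ifs_words m. L (ifs_map f I x) < L x)) \<and>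
    (alt3 \<longleftrightarrow> (\<forall>i\<in>{1..m}. L (f i x) < L x))"
proof -
  have le: "L (ifs_map f I x) \<le> L x" if "I \<in> ifs_words m" for I
    using strict_Lyapunov_ifs_map_le[OF assms(6) that] .
  have le1: "L (f i x) \<le> L x" if "i \<in> {1..m}" for i
    using le[OF singleton_ifs_words[OF that]] by simp
  have alt1: "alt1 \<longleftrightarrow> (\<forall>I\<in>ifs_words m. L (ifs_map f I x) = L x)"
    unfolding alt1_def by (rule orbitwise_chain_recurrent_iff[OF assms(6)])
  have rec: "chain_recurrent m f x \<longleftrightarrow> (\<exists>i\<in>{1..m}. L (f i x) = L x)"
    by (rule chain_recurrent_iff[OF assms(6)])
  \<comment> \<open>Since \<open>L\<close> never increases along words, a value different from
    \<open>L x\<close> must be smaller. The same remark for single letters gives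
    \<open>alt3\<close>.\<close>
  have not_alt1: "\<not> alt1 \<longleftrightarrow> (\<exists>I\<in>ifs_words m. L (ifs_map f I x) < L x)"
    unfolding alt1 using le by (metis order_less_le)
  have alt2: "alt2 \<longleftrightarrow> (\<exists>i\<in>{1..m}. L (f i x) = L x) \<and> (\<exists>I\<in>ifs_words m. L (ifs_map f I x) < L x)"
    using rec not_alt1 unfolding alt1_def alt2_def by blast
  have alt3: "alt3 \<longleftrightarrow> (\<forall>i\<in>{1..m}. L (f i x) < L x)"
    unfolding alt3_def rec using le1 by (metis order_less_le)
  \<comment> \<open>A letter must exist for orbitwise chain recurrence to imply chain recurrence:
    with \<open>m = 0\<close> the orbit would be just \<open>x\<close>, and \<open>alt1\<close> and
    \<open>alt3\<close> would both hold. Given this implication, the trichotomy is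
    propositional.\<close>
  have "1 \<in> {1..m}"
    using assms(3) by (simp add: ifs_def)
  then have "alt1 \<Longrightarrow> chain_recurrent m f x"
    unfolding alt1 rec using singleton_ifs_words ifs_map_singleton by metis
  then have "alt1 \<and> \<not> alt2 \<and> \<not> alt3 \<or> \<not> alt1 \<and> alt2 \<and> \<not> alt3 \<or> \<not> alt1 \<and> \<not> alt2 \<and> alt3"
    unfolding alt1_def alt2_def alt3_def by blast
  with alt1 alt2 alt3 show ?thesis
    by blast
qed

end
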